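(* Let $\gamma=(1+\sqrt5)/2$ and let $\xi$ be a real number which is not algebraic over $\mathbb{Q}$ of degree at most $2$. Then there exists a constant $c>0$, depending only on $\xi$, such that there are arbitrarily large real numbers $Y\ge 1$ for which there exist an irreducible monic polynomial $P\in\mathbb{Z}[T]$ of degree $3$ and an irreducible polynomial $Q\in\mathbb{Z}[T]$ of degree $2$ with the following properties: $H(P)\le Y$ and $H(Q)\le Y$, and each of $P$ and $Q$ admits at least two distinct real roots whose distance to $\xi$ is at most $cY^{-(3-\gamma)/2}$.
   Context: The height $H(P)$ of a polynomial $P$ is the largest absolute value of its coefficients. *)

theory Defs
  imports Complex_Main "HOL-Computational_Algebra.Computational_Algebra"
begin

definition poly_height :: "int poly \<Rightarrow> int"
  where "poly_height p = Max ((\<lambda>i. \<bar>coeff p i\<bar>) ` {..degree p})"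

text \<open>
  The degree over the rationals of an algebraic number, i.e. the degree of its minimal polynomial
  (a nonzero rational polynomial of least degree vanishing at the number). Only meaningful for
  numbers satisfying \<open>algebraic\<close>.
\<close>
definition algebraic_degree :: "real \<Rightarrow> nat"
  where "algebraic_degree x =
    (LEAST n. \<exists>p. (\<forall>i. coeff p i \<in> \<rat>) \<and> p \<noteq> 0 \<and> degree p = n \<and> poly p x = 0)"

definition two_close_real_roots :: "int poly \<Rightarrow> real \<Rightarrow> real \<Rightarrow> bool"
  where "two_close_real_roots p x r \<longleftrightarrow>
    (\<exists>a b :: real. a \<noteq> b \<and>
       poly (map_poly real_of_int p) a = 0 \<and> poly (map_poly real_of_int p) b = 0 \<and>
       \<bar>x - a\<bar> \<le> r \<and> \<bar>x - b\<bar> \<le> r)"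

end

theory Submission imports Defs "HOL-Analysis.Kronecker_Approximation_Theorem"
begin

text \<open>
  The number \<open>\<xi>\<close> is irrational, so it has reduced rational approximations with arbitrarily large
  denominators. Each of them gives polynomials \<open>P\<close> and \<open>Q\<close> of height at most \<open>Y\<close> with two roots
  at distance at most \<open>c / Y\<close> from \<open>\<xi>\<close>. As \<open>(3 - \<gamma>) / 2 \<le> 1\<close> and \<open>Y \<ge> 1\<close>, this is at most
  \<open>c * Y powr (- (3 - \<gamma>) / 2)\<close>.

  Take a reduced fraction \<open>p / q\<close> with \<open>\<bar>q \<xi> - p\<bar> \<le> 1 / q\<close> and \<open>q\<close> as large as desired, and complete
  \<open>(q, p)\<close> to a unimodular matrix by integers \<open>r\<close>, \<open>s\<close> with \<open>p s - q r = 1\<close> and \<open>0 \<le> s \<le> q\<close>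
  (\<open>unimodular_approximation\<close>). The linear forms \<open>L = q T - p\<close> and \<open>M = s T - r\<close> have values
  \<open>O(1 / q)\<close> at \<open>\<xi>\<close> and slopes at most \<open>q\<close>, and they are a basis of the integer polynomials of
  degree at most \<open>1\<close>. Hence \<open>L\<^sup>2\<close>, \<open>L M\<close>, \<open>M\<^sup>2\<close> are a basis of the integer polynomials of degree at
  most \<open>2\<close>, and a bounded combination of them has height \<open>O(q\<^sup>2)\<close>, value \<open>O(1 / q\<^sup>2)\<close> and derivative
  \<open>O(1)\<close> at \<open>\<xi>\<close>. Both polynomials are built from this basis, with \<open>Y\<close> a constant times \<open>q\<^sup>2\<close>.

  The quadratic is \<open>Q = L\<^sup>2 + 3 L M + M\<^sup>2\<close>. Its roots are the images of \<open>(-3 \<plusminus> sqrt 5) / 2\<close> under the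
  Moebius map of the matrix. These two numbers are negative, so no root lies near the pole of
  the map, and both roots are within \<open>O(1 / q\<^sup>2)\<close> of \<open>\<xi>\<close> (\<open>exists_quadratic\<close>). Irreducibility is
  inherited from the form \<open>x\<^sup>2 + 3 x y + y\<^sup>2\<close>, which is \<open>\<plusminus>1\<close> at three nonzero vectors
  that sum to zero modulo \<open>2\<close> (\<open>irreducible_quadratic\<close>).

  For the cubic, start with the real polynomial \<open>(T - \<xi>)\<^sup>3 + N (T - \<xi>)\<^sup>2 - h\<close>, where \<open>N\<close> is a large
  multiple of \<open>q\<^sup>2\<close> and \<open>h\<close> a multiple of \<open>1 / q\<^sup>2\<close>; it is negative at \<open>\<xi>\<close> and positive at
  \<open>\<xi> \<plusminus> 1 / q\<^sup>2\<close>. Its difference to \<open>T\<^sup>3 + T + 1\<close> has degree \<open>2\<close>; rounding the coordinates of half this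
  difference in the basis \<open>L\<^sup>2\<close>, \<open>L M\<close>, \<open>M\<^sup>2\<close> (\<open>round_quadratic\<close>) gives a monic integer cubic \<open>P\<close>
  congruent to \<open>T\<^sup>3 + T + 1\<close> modulo \<open>2\<close>. The rounding errors are too small to change the three signs,
  so \<open>P\<close> has a root on each side of \<open>\<xi>\<close>, and \<open>P\<close> is irreducible because it is odd at every integer
  (\<open>exists_cubic\<close>).
\<close>

section \<open>Irreducibility criteria in degrees two and three\<close>

lemma degree_le_1_obtain:
  fixes p :: "'a::comm_ring_1 poly"
  assumes "degree p \<le> 1"
  obtains a0 a1 where "p = [:a0, a1:]"
proof -
  have "p = [:coeff p 0, coeff p 1:]"
  proof (rule poly_eqI)
    fix n show "coeff p n = coeff [:coeff p 0, coeff p 1:] n"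
    proof (cases "n \<le> 1")
      case True
      then show ?thesis by (cases n) auto
    next
      case False
      then show ?thesis using assms by (simp add: coeff_eq_0 coeff_pCons split: nat.split)
    qed
  qed
  then show ?thesis using that by blast
qed

text \<open>
  A proper factorisation has a linear factor, whose leading coefficient divides \<open>1\<close>, so that
  its root is an integer.
\<close>
lemma irreducible_monic_cubic:
  fixes p :: "int poly"
  assumes "lead_coeff p = 1" "degree p = 3" and no_root: "\<And>n. poly p n \<noteq> 0"
  shows "irreducible p"
proof (rule irreducibleI)
  show "p \<noteq> 0" using assms(2) by auto
  show "\<not> p dvd 1" using assms(2) by (auto simp: is_unit_poly_iff)
  have key: "a dvd 1" if ab: "p = a * b" and deg: "degree a \<le> 1" for a b
  proof -
    obtain a0 a1 where a: "a = [:a0, a1:]" using degree_le_1_obtain[OF deg] .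
    have lc: "lead_coeff a dvd 1" using assms(1) unfolding ab by (metis dvd_triv_left lead_coeff_mult)
    show ?thesis
    proof (cases "a1 = 0")
      case True
      then show ?thesis using lc a by (simp add: is_unit_const_poly_iff)
    next
      case False
      then have "a1 * a1 = 1" using lc a by (auto simp: zdvd1_eq abs_if split: if_splits)
      then have "poly a (- a0 * a1) = 0" using a by (simp add: algebra_simps)
      then have "poly p (- a0 * a1) = 0" by (simp add: ab)
      then show ?thesis using no_root by blast
    qed
  qed
  fix a b assume ab: "p = a * b"
  then have "degree a + degree b = 3" using \<open>p \<noteq> 0\<close> assms(2) by (metis degree_mult_eq mult_eq_0_iff)
  then consider "degree a \<le> 1" | "degree b \<le> 1" by linarith
  then show "a dvd 1 \<or> b dvd 1"
    using key[of a b] key[of b a] ab by (metis mult.commute)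
qed

text \<open>
  The form \<open>f\<close> is the homogenisation of the polynomial. If the polynomial were a product of two
  linear factors, then \<open>f\<close> would be a product of two linear forms with odd values at \<open>(x, y)\<close>,
  \<open>(x', y')\<close> and their sum, although the third value is the sum of the other two. A constant factor
  divides all values of \<open>f\<close>, so the value \<open>\<plusminus>1\<close> makes it a unit.
\<close>
lemma irreducible_quadratic:
  fixes A B C x y x' y' :: int
  defines "f \<equiv> \<lambda>x y. A * x^2 + B * x * y + C * y^2"
  assumes A: "A \<noteq> 0"
    and f: "\<bar>f x y\<bar> = 1" "\<bar>f x' y'\<bar> = 1" "\<bar>f (x + x') (y + y')\<bar> = 1"
  shows "irreducible [:C, B, A:]"
proof (rule irreducibleI)
  let ?p = "[:C, B, A:]"
  show p0: "?p \<noteq> 0" using A by auto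
  show "\<not> ?p dvd 1" using A by (auto simp: is_unit_poly_iff)
  have const: "a dvd 1" if ab: "?p = a * b" and "degree a = 0" for a b
  proof -
    obtain k where k: "a = [:k:]" using \<open>degree a = 0\<close> by (metis degree_eq_zeroE)
    have "k dvd C" "k dvd B" "k dvd A"
      using ab k by (metis dvd_triv_left const_poly_dvd_iff coeff_pCons_0 coeff_pCons_Suc)+
    then have "k dvd f x y" unfolding f_def by auto
    then have "k dvd 1" using f(1) by (metis dvd_abs_iff)
    then show ?thesis using k by (simp add: is_unit_const_poly_iff)
  qed
  fix a b assume ab: "?p = a * b"
  have deg: "degree a + degree b = 2"
    using degree_mult_eq[of a b] p0 A unfolding ab[symmetric] by (metis ab degree_pCons_eq_if mult_eq_0_iff numeral_2_eq_2 pCons_eq_0_iff)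
  show "a dvd 1 \<or> b dvd 1"
  proof (cases "degree a = 0 \<or> degree b = 0")
    case True
    then show ?thesis using const[of a b] const[of b a] ab by (metis mult.commute)
  next
    case False
    then have "degree a \<le> 1" "degree b \<le> 1" using deg by auto
    then obtain a0 a1 b0 b1 where a: "a = [:a0, a1:]" and b: "b = [:b0, b1:]"
      using degree_le_1_obtain by metis
    have C: "C = a0 * b0" "B = a0 * b1 + a1 * b0" "A = a1 * b1"
      using ab unfolding a b by (auto simp: algebra_simps)
    have split: "f u v = (a1 * u + a0 * v) * (b1 * u + b0 * v)" for u v
      unfolding f_def C by (simp add: algebra_simps power2_eq_square)
    have unit: "odd (a1 * u + a0 * v)" if "\<bar>f u v\<bar> = 1" for u v
    proof -
      have "odd (f u v)" using that by presburger
      then show ?thesis unfolding split by simp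
    qed
    have "odd (a1 * (x + x') + a0 * (y + y'))" using unit[OF f(3)] .
    moreover have "a1 * (x + x') + a0 * (y + y') = (a1 * x + a0 * y) + (a1 * x' + a0 * y')"
      by (simp add: algebra_simps)
    ultimately show ?thesis using unit[OF f(1)] unit[OF f(2)] by simp
  qed
qed

section \<open>Heights, real evaluation and products\<close>

lemma poly_height_le:
  assumes "\<And>i. i \<le> degree p \<Longrightarrow> real_of_int \<bar>coeff p i\<bar> \<le> Y"
  shows "real_of_int (poly_height p) \<le> Y"
proof -
  have "poly_height p \<in> (\<lambda>i. \<bar>coeff p i\<bar>) ` {..degree p}"
    unfolding poly_height_def by (intro Max_in) auto
  then show ?thesis using assms by auto
qed

lemma poly_map_real_quadratic:
  "poly (map_poly real_of_int [:c, b, a:]) x = a * x^2 + b * x + c"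
  by (simp add: map_poly_pCons algebra_simps power2_eq_square)

lemma poly_map_real_cubic:
  "poly (map_poly real_of_int [:d, c, b, a:]) x = a * x^3 + b * x^2 + c * x + d"
  by (simp add: map_poly_pCons algebra_simps power2_eq_square power3_eq_cube)

lemma two_close_real_roots_mono:
  assumes "two_close_real_roots p x \<delta>" "\<delta> \<le> \<epsilon>"
  shows "two_close_real_roots p x \<epsilon>"
  using assms unfolding two_close_real_roots_def by (meson order.trans)

lemma abs_weighted_product_le:
  fixes e x y m :: real
  assumes "0 \<le> e" "e \<le> 1" "\<bar>x\<bar> \<le> m" "\<bar>y\<bar> \<le> n"
  shows "\<bar>e * (x * y)\<bar> \<le> m * n"
proof -
  have "\<bar>x\<bar> * \<bar>y\<bar> \<le> m * n" using assms by (intro mult_mono) auto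
  moreover have "e * (\<bar>x\<bar> * \<bar>y\<bar>) \<le> 1 * (\<bar>x\<bar> * \<bar>y\<bar>)"
    using assms by (intro mult_right_mono) auto
  ultimately show ?thesis using assms by (simp add: abs_mult)
qed

section \<open>Unimodular approximation and rounding\<close>

text \<open>
  Dirichlet's theorem provides \<open>p / q\<close>. The second row can be reduced modulo the first, so that
  \<open>0 \<le> s \<le> q\<close>; then \<open>s \<xi> - r = (s / q) (q \<xi> - p) + 1 / q\<close> is as small as \<open>q \<xi> - p\<close> up to a factor \<open>2\<close>.
\<close>
lemma unimodular_approximation:
  fixes \<xi> B :: real
  assumes "\<xi> \<notin> \<rat>"
  obtains p q r s :: int
  where "p * s - q * r = 1" "q > 0" "real_of_int q > B" "0 \<le> s" "s \<le> q"
    "\<bar>q * \<xi> - p\<bar> \<le> 1 / q" "\<bar>s * \<xi> - r\<bar> \<le> 2 / q"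
proof -
  have "infinite (approx_set \<xi>)" using assms rational_iff_finite_approx_set by blast
  then obtain p q where pq: "(p, q) \<in> approx_set \<xi>" "q > \<lceil>B\<rceil>"
    using infinite_approx_set by blast
  then have q: "q > 0" "coprime p q" "\<bar>\<xi> - p / q\<bar> < 1 / q^2" by (auto simp: approx_set_def)
  have qB: "real_of_int q > B" using pq(2) by linarith
  have "\<bar>q * \<xi> - p\<bar> = q * \<bar>\<xi> - p / q\<bar>" using q(1)
    by (simp add: abs_mult_pos' [symmetric] abs_mult field_simps flip: abs_mult)
  also have "\<dots> \<le> q * (1 / q^2)" using q by (intro mult_left_mono) auto
  also have "\<dots> = 1 / q" using q by (simp add: power2_eq_square)
  finally have L: "\<bar>q * \<xi> - p\<bar> \<le> 1 / q" .
  obtain u v where uv: "u * p + v * q = 1" using bezout_int[of p q] q(2) by (metis coprime_iff_gcd_eq_1)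
  define s where "s = u mod q"
  define r where "r = - v - p * (u div q)"
  have s: "0 \<le> s" "s \<le> q" using q(1) by (auto simp: s_def less_imp_le)
  have "u = q * (u div q) + s" by (simp add: s_def)
  then have det: "p * s - q * r = 1" unfolding r_def using uv by algebra
  have "s * \<xi> - r = (s / q) * (q * \<xi> - p) + 1 / q"
  proof -
    have "real_of_int p * s - q * r = 1" using det by (metis of_int_1 of_int_diff of_int_mult)
    then show ?thesis using q(1) by (simp add: field_simps)
  qed
  also have "\<bar>\<dots>\<bar> \<le> (s / q) * \<bar>q * \<xi> - p\<bar> + 1 / q"
    using s q(1) by (intro order.trans[OF abs_triangle_ineq]) (simp add: abs_mult)
  also have "\<dots> \<le> 1 * (1 / q) + 1 / q"
    using s q(1) L by (intro add_mono mult_mono) auto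
  finally have "\<bar>s * \<xi> - r\<bar> \<le> 2 / q" by simp
  then show ?thesis using that det q(1) qB s L by blast
qed

text \<open>
  Coefficient by coefficient, this says that \<open>u0 + u1 T + u2 T\<^sup>2\<close> equals an integer polynomial plus
  \<open>e1 L\<^sup>2 + e2 L M + e3 M\<^sup>2\<close>, where \<open>L = q T - p\<close> and \<open>M = s T - r\<close>. The coordinates in the basis
  \<open>L\<^sup>2\<close>, \<open>L M\<close>, \<open>M\<^sup>2\<close> come from the inverse substitution \<open>1 = q M - s L\<close>, \<open>T = p M - r L\<close>, and the
  \<open>e\<close>s are their fractional parts.
\<close>
lemma round_quadratic:
  fixes p q r s :: int and u0 u1 u2 :: real
  assumes det: "p * s - q * r = 1"
  obtains a0 a1 a2 :: int and e1 e2 e3 :: real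
  where "0 \<le> e1" "e1 \<le> 1" "0 \<le> e2" "e2 \<le> 1" "0 \<le> e3" "e3 \<le> 1"
    "u2 = a2 + (e1 * q^2 + e2 * (q * s) + e3 * s^2)"
    "u1 = a1 - (e1 * (2 * p * q) + e2 * (p * s + q * r) + e3 * (2 * r * s))"
    "u0 = a0 + (e1 * p^2 + e2 * (p * r) + e3 * r^2)"
proof -
  have rdet: "real_of_int p * s - q * r = 1" using det by (metis of_int_1 of_int_diff of_int_mult)
  define x y z where
    "x = u2 * r^2 + u1 * (r * s) + u0 * s^2" and
    "y = - (u2 * (2 * p * r) + u1 * (p * s + q * r) + u0 * (2 * q * s))" and
    "z = u2 * p^2 + u1 * (p * q) + u0 * q^2"
  have u: "u2 = x * q^2 + y * (q * s) + z * s^2"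
    "u1 = - (x * (2 * p * q) + y * (p * s + q * r) + z * (2 * r * s))"
    "u0 = x * p^2 + y * (p * r) + z * r^2"
    using rdet unfolding x_def y_def z_def by (simp; algebra)+
  show ?thesis
    by (rule that[of "frac x" "frac y" "frac z"
        "\<lfloor>x\<rfloor> * q^2 + \<lfloor>y\<rfloor> * (q * s) + \<lfloor>z\<rfloor> * s^2"
        "- (\<lfloor>x\<rfloor> * (2 * p * q) + \<lfloor>y\<rfloor> * (p * s + q * r) + \<lfloor>z\<rfloor> * (2 * r * s))"
        "\<lfloor>x\<rfloor> * p^2 + \<lfloor>y\<rfloor> * (p * r) + \<lfloor>z\<rfloor> * r^2"])
      ((auto simp: u frac_def algebra_simps), linarith+)
qed

section \<open>Polynomials from an approximating unimodular basis\<close>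

locale unimodular_approx =
  fixes \<xi> K :: real and p q r s :: int
  assumes det: "p * s - q * r = 1" and q: "q > 0" and s: "0 \<le> s" "s \<le> q"
    and L: "\<bar>q * \<xi> - p\<bar> \<le> 1 / q" and M: "\<bar>s * \<xi> - r\<bar> \<le> 2 / q"
    and K_def: "K = \<bar>\<xi>\<bar> + 2"
begin

lemma real_det: "real_of_int p * s - q * r = 1"
  using det by (metis of_int_1 of_int_diff of_int_mult)

lemma q_ge_1: "real_of_int q \<ge> 1" using q by simp

lemma K_ge_2: "K \<ge> 2" by (simp add: K_def)

lemma entries_le:
  "\<bar>real_of_int p\<bar> \<le> K * q" "\<bar>real_of_int q\<bar> \<le> K * q"
  "\<bar>real_of_int r\<bar> \<le> K * q" "\<bar>real_of_int s\<bar> \<le> K * q"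
proof -
  have i: "1 / real_of_int q \<le> q" "2 / real_of_int q \<le> 2 * q"
    using q_ge_1 mult_mono[of 1 "real_of_int q" 1 "real_of_int q"] by (auto simp: field_simps)
  have "\<bar>q * \<xi>\<bar> = q * \<bar>\<xi>\<bar>" "\<bar>s * \<xi>\<bar> \<le> q * \<bar>\<xi>\<bar>"
    using q s by (auto simp: abs_mult intro!: mult_right_mono)
  moreover have K: "K * q = q * \<bar>\<xi>\<bar> + 2 * q" by (simp add: K_def algebra_simps)
  ultimately show "\<bar>real_of_int p\<bar> \<le> K * q" "\<bar>real_of_int r\<bar> \<le> K * q"
    using L M i by linarith+
  have "0 \<le> q * \<bar>\<xi>\<bar>" "0 \<le> real_of_int s" "real_of_int s \<le> q" using q s by auto
  then show "\<bar>real_of_int q\<bar> \<le> K * q" "\<bar>real_of_int s\<bar> \<le> K * q"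
    using K q_ge_1 by linarith+
qed

text \<open>
  All terms in the height estimates are absorbed into a single scale \<open>Z\<close>, so that the estimates
  become linear arithmetic.
\<close>
lemma scale_bounds:
  fixes Z :: real
  defines "Z \<equiv> K^3 * q^2"
  shows "8 * q^2 \<le> Z" "4 * (K * q^2) \<le> Z" "2 * (K * q)^2 \<le> Z" "8 \<le> Z" 
    "4 * K \<le> Z" "2 * K^2 \<le> Z" "K^3 \<le> Z"
proof -
  have q2: "1 \<le> (real_of_int q)^2" using q_ge_1 by simp
  have K: "2 * K \<le> K^2" "2 * K^2 \<le> K^3"
    using K_ge_2 by (auto simp: power2_eq_square power3_eq_cube)
  have K': "8 \<le> K^3" "4 * K \<le> K^3" using K K_ge_2 by auto
  have up: "x * q^2 \<le> Z" "x \<le> Z" if "x \<le> K^3" "0 \<le> x" for x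
  proof -
    show "x * q^2 \<le> Z" unfolding Z_def using that by (simp add: mult_right_mono)
    moreover have "x * 1 \<le> x * q^2" using that q2 by (intro mult_left_mono) auto
    ultimately show "x \<le> Z" by simp
  qed
  show "8 * q^2 \<le> Z" using up(1)[OF K'(1)] by simp
  show "4 * (K * q^2) \<le> Z" using up(1)[OF K'(2)] K_ge_2 by (simp add: mult.assoc)
  show "2 * (K * q)^2 \<le> Z" using up(1)[OF K(2)] by (simp add: power_mult_distrib mult.assoc)
  show "8 \<le> Z" "4 * K \<le> Z" "2 * K^2 \<le> Z" "K^3 \<le> Z"
    using up(2) K K' K_ge_2 by auto
qed

text \<open>
  A root \<open>\<theta>\<close> of \<open>x\<^sup>2 + 3 x + 1\<close> gives the root of \<open>Q\<close> at which \<open>L = \<theta> M\<close>, namely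
  \<open>(p - \<theta> r) / (q - \<theta> s)\<close>. As \<open>\<theta> < 0 \<le> s\<close>, the denominator is at least \<open>q\<close>.
\<close>
lemma exists_quadratic:
  obtains Q :: "int poly"
  where "irreducible Q" "degree Q = 2" "real_of_int (poly_height Q) \<le> 40 * K^3 * q^2"
    "two_close_real_roots Q \<xi> (7 / q^2)"
proof -
  define a where "a = q^2 + 3 * (q * s) + s^2"
  define b where "b = - (2 * p * q + 3 * (p * s + q * r) + 2 * r * s)"
  define c where "c = p^2 + 3 * (p * r) + r^2"
  have a: "a > 0" using q s by (simp add: a_def add_pos_nonneg)
  let ?Q = "[:c, b, a:]"
  have "irreducible ?Q"
  \<comment> \<open>at \<open>(r, s)\<close>, \<open>(p, q)\<close> and their sum the pair \<open>(L, M)\<close> takes the values \<open>(-1, 0)\<close>, \<open>(0, 1)\<close>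
      and \<open>(-1, 1)\<close>\<close>
  proof (rule irreducible_quadratic[where x = r and y = s and x' = p and y' = q])
    have form: "a * x^2 + b * x * y + c * y^2
      = (q * x - p * y)^2 + 3 * (q * x - p * y) * (s * x - r * y) + (s * x - r * y)^2" for x y
      unfolding a_def b_def c_def by algebra
    have v: "q * r - p * s = -1" "s * r - r * s = 0" "q * p - p * q = 0" "s * p - r * q = 1"
      "q * (r + p) - p * (s + q) = -1" "s * (r + p) - r * (s + q) = 1"
      using det by (auto simp: algebra_simps)
    show "\<bar>a * r^2 + b * r * s + c * s^2\<bar> = 1" "\<bar>a * p^2 + b * p * q + c * q^2\<bar> = 1"
      "\<bar>a * (r + p)^2 + b * (r + p) * (s + q) + c * (s + q)^2\<bar> = 1"
      unfolding form v by simp_all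
  qed (use a in auto)
  moreover have "real_of_int (poly_height ?Q) \<le> 40 * K^3 * q^2"
  proof (rule poly_height_le)
    let ?X = "K * q"
    have b2: "\<bar>real_of_int x * y\<bar> \<le> ?X^2"
      if "\<bar>real_of_int x\<bar> \<le> ?X" "\<bar>real_of_int y\<bar> \<le> ?X" for x y
      using abs_weighted_product_le[of 1, OF _ _ that] by (simp add: power2_eq_square)
    note e = entries_le
    have "\<bar>real_of_int a\<bar> \<le> 10 * ?X^2"
      using b2[OF e(2,2)] b2[OF e(2,4)] b2[OF e(4,4)] zero_le_square[of "real_of_int q"]
      unfolding a_def power2_eq_square of_int_add of_int_mult of_int_power of_int_numeral
      by linarith
    moreover have "\<bar>real_of_int b\<bar> \<le> 10 * ?X^2"
      using b2[OF e(1,2)] b2[OF e(1,4)] b2[OF e(2,3)] b2[OF e(3,4)] by (simp add: b_def)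
    moreover have "\<bar>real_of_int c\<bar> \<le> 10 * ?X^2"
      using b2[OF e(1,1)] b2[OF e(1,3)] b2[OF e(3,3)] zero_le_square[of "real_of_int p"]
      unfolding c_def power2_eq_square of_int_add of_int_mult of_int_power of_int_numeral
      by linarith
    moreover have "10 * ?X^2 \<le> 40 * K^3 * q^2" using scale_bounds(3,4) by linarith
    ultimately show "real_of_int \<bar>coeff ?Q i\<bar> \<le> 40 * K^3 * q^2" if "i \<le> degree ?Q" for i
      using scale_bounds(4) by (auto simp: coeff_pCons split: nat.split)
  qed
  moreover have "two_close_real_roots ?Q \<xi> (7 / q^2)"
  proof -
    define root where "root \<theta> = (p - \<theta> * r) / (q - \<theta> * s)" for \<theta> :: real
    have root: "poly (map_poly real_of_int ?Q) (root \<theta>) = 0 \<and> \<bar>\<xi> - root \<theta>\<bar> \<le> 7 / q^2 \<and> q - \<theta> * s > 0"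
      if \<theta>: "\<theta>^2 + 3 * \<theta> + 1 = 0" "\<theta> \<le> 0" "-3 \<le> \<theta>" for \<theta> :: real
    proof (intro conjI)
      have "\<theta> * s \<le> 0" using that s by (simp add: mult_nonpos_nonneg)
      then have den: "q - \<theta> * s \<ge> q" by simp
      then show pos: "q - \<theta> * s > 0" using q_ge_1 by linarith
      have l: "q * root \<theta> - p = \<theta> / (q - \<theta> * s)" and m: "s * root \<theta> - r = 1 / (q - \<theta> * s)"
        using pos real_det unfolding root_def by (simp add: field_simps; algebra?)+
      have "poly (map_poly real_of_int ?Q) (root \<theta>)
        = (q * root \<theta> - p)^2 + 3 * ((q * root \<theta> - p) * (s * root \<theta> - r)) + (s * root \<theta> - r)^2"
        unfolding poly_map_real_quadratic a_def b_def c_def by (simp; algebra)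
      also have "\<dots> = (\<theta>^2 + 3 * \<theta> + 1) / (q - \<theta> * s)^2"
        unfolding l m using pos by (simp add: power2_eq_square add_divide_distrib)
      finally show "poly (map_poly real_of_int ?Q) (root \<theta>) = 0" using \<theta> by simp
      have "\<xi> - root \<theta> = ((q * \<xi> - p) - \<theta> * (s * \<xi> - r)) / (q - \<theta> * s)"
        using pos unfolding root_def by (simp add: field_simps)
      also have "\<bar>\<dots>\<bar> \<le> (7 / q) / q"
        unfolding abs_divide
      proof (rule frac_le)
        have "\<bar>\<theta> * (s * \<xi> - r)\<bar> \<le> 3 * (2 / q)"
          unfolding abs_mult using \<theta> M by (intro mult_mono) auto
        then show "\<bar>(q * \<xi> - p) - \<theta> * (s * \<xi> - r)\<bar> \<le> 7 / q"
          using L by (simp add: abs_le_iff)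
      qed (use pos den q in auto)
      finally show "\<bar>\<xi> - root \<theta>\<bar> \<le> 7 / q^2" by (simp add: power2_eq_square)
    qed
    define \<theta> \<theta>' where "\<theta> = (-3 + sqrt 5) / 2" and "\<theta>' = (-3 - sqrt 5) / 2"
    have s5: "sqrt 5 < 3" "sqrt 5 > 0" by (auto simp: real_less_lsqrt)
    then have s5': "-3 \<le> sqrt 5" by linarith
    have eqs: "\<theta>^2 + 3 * \<theta> + 1 = 0" "\<theta>'^2 + 3 * \<theta>' + 1 = 0"
      by (auto simp: \<theta>_def \<theta>'_def power2_eq_square field_simps)
    have range: "\<theta> \<le> 0" "-3 \<le> \<theta>" "\<theta>' \<le> 0" "-3 \<le> \<theta>'"
      using s5 s5' by (auto simp: \<theta>_def \<theta>'_def)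
    have R: "poly (map_poly real_of_int ?Q) (root \<theta>) = 0 \<and> \<bar>\<xi> - root \<theta>\<bar> \<le> 7 / q^2 \<and> q - \<theta> * s > 0"
      "poly (map_poly real_of_int ?Q) (root \<theta>') = 0 \<and> \<bar>\<xi> - root \<theta>'\<bar> \<le> 7 / q^2 \<and> q - \<theta>' * s > 0"
      using root[OF eqs(1)] root[OF eqs(2)] range by blast+
    have "root \<theta> \<noteq> root \<theta>'"
    proof
      assume "root \<theta> = root \<theta>'"
      then have "(p - \<theta> * r) * (q - \<theta>' * s) = (p - \<theta>' * r) * (q - \<theta> * s)"
        using R unfolding root_def by (simp add: frac_eq_eq)
      then have "\<theta> - \<theta>' = 0" using real_det by (simp; algebra)
      then show False using s5 by (simp add: \<theta>_def \<theta>'_def)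
    qed
    then show ?thesis unfolding two_close_real_roots_def using R by blast
  qed
  ultimately show ?thesis using that a by simp
qed

text \<open>
  In the variable \<open>x - \<xi>\<close> the cubic is \<open>(x - \<xi>)\<^sup>3 + N (x - \<xi>)\<^sup>2 - h - 2 E x\<close> with the rounding error
  \<open>E = e1 L\<^sup>2 + e2 L M + e3 M\<^sup>2\<close>. With \<open>d = 1 / q\<^sup>2\<close> the bounds on \<open>L\<close> and \<open>M\<close> give \<open>2 \<bar>E\<bar> \<le> 14 d\<close> at \<open>\<xi>\<close> and
  \<open>2 \<bar>E\<bar> \<le> 38 d\<close> at distance \<open>d\<close>. This dictates \<open>h = 15 d\<close>, and then \<open>N = 55 q\<^sup>2\<close>, for which
  \<open>N d\<^sup>2 = 55 d\<close> exceeds \<open>15 d + 38 d\<close> by more than the cubic term, which is at most \<open>d\<close>.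
\<close>
lemma exists_cubic:
  obtains P :: "int poly"
  where "irreducible P" "lead_coeff P = 1" "degree P = 3"
    "real_of_int (poly_height P) \<le> 40 * K^3 * q^2"
    "two_close_real_roots P \<xi> (1 / q^2)"
proof -
  define N where "N = 55 * (real_of_int q)^2"
  define h where "h = 15 / (real_of_int q)^2"
  \<comment> \<open>the quadratic polynomial rounded here is
      \<open>((T - \<xi>)\<^sup>3 + N (T - \<xi>)\<^sup>2 - h - T\<^sup>3 - T - 1) / 2\<close>\<close>
  obtain a0 a1 a2 :: int and e1 e2 e3 :: real
    where e: "0 \<le> e1" "e1 \<le> 1" "0 \<le> e2" "e2 \<le> 1" "0 \<le> e3" "e3 \<le> 1"
    and u2: "(N - 3 * \<xi>) / 2 = a2 + (e1 * q^2 + e2 * (q * s) + e3 * s^2)"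
    and u1: "(3 * \<xi>^2 - 2 * N * \<xi> - 1) / 2
        = a1 - (e1 * (2 * p * q) + e2 * (p * s + q * r) + e3 * (2 * r * s))"
    and u0: "(N * \<xi>^2 - \<xi>^3 - h - 1) / 2 = a0 + (e1 * p^2 + e2 * (p * r) + e3 * r^2)"
    by (rule round_quadratic[OF det])
  let ?P = "[:1 + 2 * a0, 1 + 2 * a1, 2 * a2, 1:]"
  have "irreducible ?P"
  proof (rule irreducible_monic_cubic)
    fix n
    have "poly ?P n = 2 * (a0 + a1 * n + a2 * n^2) + n * (n^2 + 1) + 1"
      by (simp add: algebra_simps power2_eq_square)
    moreover have "even (n * (n^2 + 1))" by simp
    ultimately have "odd (poly ?P n)" by simp
    then show "poly ?P n \<noteq> 0" by (metis even_zero)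
  qed auto
  moreover have "real_of_int (poly_height ?P) \<le> 40 * K^3 * q^2"
  proof (rule poly_height_le)
    let ?X = "K * q"
    have w: "\<bar>e * (real_of_int x * y)\<bar> \<le> ?X^2"
      if "0 \<le> e" "e \<le> 1" "\<bar>real_of_int x\<bar> \<le> ?X" "\<bar>real_of_int y\<bar> \<le> ?X" for e x y
      using abs_weighted_product_le[OF that] by (simp add: power2_eq_square)
    note e' = entries_le
    have \<xi>: "\<bar>\<xi>\<bar> \<le> K" by (simp add: K_def)
    have \<xi>2: "\<bar>\<xi>^2\<bar> \<le> K^2" "\<bar>\<xi>^3\<bar> \<le> K^3"
      using power_mono[OF \<xi>, of 2] power_mono[OF \<xi>, of 3] by (simp_all add: power_abs)
    have N\<xi>: "\<bar>N * \<xi>\<bar> \<le> 55 * (K * q^2)" "\<bar>N * \<xi>^2\<bar> \<le> 55 * (K * q)^2"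
      using mult_left_mono[OF \<xi>, of N] mult_left_mono[OF \<xi>2(1), of N]
      by (auto simp: N_def abs_mult power_mult_distrib mult_ac)
    have h: "0 \<le> h" "h \<le> 15"
      using q_ge_1 by (auto simp: h_def divide_le_eq)
    define Z where "Z = K^3 * real_of_int (q^2)"
    note Z = scale_bounds[folded Z_def]
    have N: "0 \<le> N" "8 * N \<le> 55 * Z" using Z(1) by (auto simp: N_def)
    have "real_of_int (2 * a2) = N - 3 * \<xi> - 2 * (e1 * (real_of_int q * q))
        - 2 * (e2 * (real_of_int q * s)) - 2 * (e3 * (real_of_int s * s))"
      using u2 by (simp add: field_simps power2_eq_square)
    then have "\<bar>real_of_int (2 * a2)\<bar> \<le> 40 * Z"
      using w[OF e(1,2) e'(2,2)] w[OF e(3,4) e'(2,4)] w[OF e(5,6) e'(4,4)] \<xi> Z N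
      unfolding abs_le_iff by linarith
    moreover have "real_of_int (1 + 2 * a1) = 3 * \<xi>^2 - 2 * (N * \<xi>)
        + 4 * (e1 * (real_of_int p * q)) + 2 * (e2 * (real_of_int p * s))
        + 2 * (e2 * (real_of_int q * r)) + 4 * (e3 * (real_of_int r * s))"
      using u1 by (simp add: field_simps)
    then have "\<bar>real_of_int (1 + 2 * a1)\<bar> \<le> 40 * Z"
      using w[OF e(1,2) e'(1,2)] w[OF e(3,4) e'(1,4)] w[OF e(3,4) e'(2,3)] w[OF e(5,6) e'(3,4)]
        \<xi>2 N\<xi> Z
      unfolding abs_le_iff by linarith
    moreover have "real_of_int (1 + 2 * a0) = N * \<xi>^2 - \<xi>^3 - h
        - 2 * (e1 * (real_of_int p * p)) - 2 * (e2 * (real_of_int p * r))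
        - 2 * (e3 * (real_of_int r * r))"
      using u0 by (simp add: field_simps power2_eq_square)
    then have "\<bar>real_of_int (1 + 2 * a0)\<bar> \<le> 40 * Z"
      using w[OF e(1,2) e'(1,1)] w[OF e(3,4) e'(1,3)] w[OF e(5,6) e'(3,3)] \<xi>2 N\<xi> Z h
      unfolding abs_le_iff by linarith
    moreover have "40 * K^3 * q^2 = 40 * Z" by (simp add: Z_def)
    ultimately show "real_of_int \<bar>coeff ?P i\<bar> \<le> 40 * K^3 * q^2" if "i \<le> degree ?P" for i
      using Z(4) by (auto simp: coeff_pCons split: nat.split)
  qed
  moreover have "two_close_real_roots ?P \<xi> (1 / q^2)"
  proof -
    define f where "f = poly (map_poly real_of_int ?P)"
    define E where "E x = e1 * ((q * x - p) * (q * x - p)) + e2 * ((q * x - p) * (s * x - r))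
        + e3 * ((s * x - r) * (s * x - r))" for x :: real
    have f: "f x = (x - \<xi>)^3 + N * (x - \<xi>)^2 - h - 2 * E x" for x :: real
    proof -
      have "f x = x^3 + (2 * a2) * x^2 + (1 + 2 * a1) * x + (1 + 2 * a0)"
        by (simp add: f_def poly_map_real_cubic)
      then show ?thesis using u0 u1 u2 unfolding E_def by (simp; algebra)
    qed
    have E_le: "\<bar>E x\<bar> \<le> l * l + l * m + m * m"
      if "\<bar>q * x - p\<bar> \<le> l" "\<bar>s * x - r\<bar> \<le> m" for x l m :: real
      using abs_weighted_product_le[OF e(1,2) that(1,1)] abs_weighted_product_le[OF e(3,4) that]
        abs_weighted_product_le[OF e(5,6) that(2,2)]
      unfolding E_def by linarith
    define d where "d = 1 / (real_of_int q)^2"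
    have d: "0 < d" "d \<le> 1" using q_ge_1 by (auto simp: d_def)
    have "\<bar>E \<xi>\<bar> \<le> 7 * d"
      using E_le[OF L M] by (simp add: d_def power2_eq_square field_simps)
    moreover have h: "h = 15 * d" by (simp add: h_def d_def)
    ultimately have neg: "f \<xi> < 0" using d by (simp add: f abs_le_iff)
    have pos: "f x > 0" if x: "\<bar>x - \<xi>\<bar> = d" for x :: real
    proof -
      have qd: "q * d = 1 / q" by (simp add: d_def power2_eq_square)
      have "q * x - p = (q * \<xi> - p) + q * (x - \<xi>)" by (simp add: algebra_simps)
      also have "\<bar>\<dots>\<bar> \<le> 1 / q + q * d"
        using L q x by (intro order.trans[OF abs_triangle_ineq] add_mono) (auto simp: abs_mult)
      finally have l: "\<bar>q * x - p\<bar> \<le> 2 / q" by (simp add: qd)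
      have "s * x - r = (s * \<xi> - r) + s * (x - \<xi>)" by (simp add: algebra_simps)
      also have "\<bar>\<dots>\<bar> \<le> 2 / q + q * d"
        using M s x d by (intro order.trans[OF abs_triangle_ineq] add_mono)
          (auto simp: abs_mult intro!: mult_right_mono)
      finally have m: "\<bar>s * x - r\<bar> \<le> 3 / q" by (simp add: qd)
      have "\<bar>E x\<bar> \<le> 19 * d"
        using E_le[OF l m] by (simp add: d_def power2_eq_square field_simps)
      moreover have "N * (x - \<xi>)^2 = 55 * d"
      proof -
        have "(x - \<xi>)^2 = d^2" using x by (metis power2_abs)
        then show ?thesis using q by (simp add: N_def d_def power2_eq_square)
      qed
      moreover have "\<bar>(x - \<xi>)^3\<bar> \<le> d"
        unfolding power_abs x using d power_decreasing[of 1 3 d] by simp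
      ultimately show ?thesis using d(1) h unfolding f by linarith
    qed
    have cont: "isCont f x" for x by (simp add: f_def)
    obtain y where y: "\<xi> \<le> y" "y \<le> \<xi> + d" "f y = 0"
      using IVT[of f \<xi> 0 "\<xi> + d"] neg pos[of "\<xi> + d"] d cont by force
    obtain z where z: "\<xi> - d \<le> z" "z \<le> \<xi>" "f z = 0"
      using IVT2[of f \<xi> 0 "\<xi> - d"] neg pos[of "\<xi> - d"] d cont by force
    have "y \<noteq> z" using y z neg by force
    then show ?thesis unfolding two_close_real_roots_def
      using y z by (intro exI[of _ y] exI[of _ z]) (auto simp: f_def d_def)
  qed
  ultimately show ?thesis
    by (intro that[of ?P]) (simp_all add: numeral_3_eq_3)
qed

end

section \<open>The approximation theorem\<close>

lemma Rats_algebraic_degree_le_1: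
  assumes "x \<in> \<rat>"
  shows "algebraic_degree x \<le> 1"
  unfolding algebraic_degree_def
proof (rule Least_le, intro exI conjI allI)
  show "coeff [:- x, 1:] i \<in> \<rat>" for i
    using assms by (auto simp: coeff_pCons split: nat.split)
qed auto

theorem mainTheorem2:
  fixes \<xi> \<gamma> :: real
  assumes "\<gamma> = (1 + sqrt 5) / 2"
    and "\<not> (algebraic \<xi> \<and> algebraic_degree \<xi> \<le> 2)"
  shows "\<exists>c :: real. c > 0 \<and>
    (\<forall>B :: real. \<exists>Y :: real. Y \<ge> B \<and> Y \<ge> 1 \<and>
      (\<exists>P Q :: int poly.
         irreducible P \<and> lead_coeff P = 1 \<and> degree P = 3 \<and>
         irreducible Q \<and> degree Q = 2 \<and>
         real_of_int (poly_height P) \<le> Y \<and> real_of_int (poly_height Q) \<le> Y \<and>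
         two_close_real_roots P \<xi> (c * Y powr (- (3 - \<gamma>) / 2)) \<and>
         two_close_real_roots Q \<xi> (c * Y powr (- (3 - \<gamma>) / 2))))"
proof -
  have irrational: "\<xi> \<notin> \<rat>"
    using assms(2) Rats_algebraic_degree_le_1[of \<xi>] rat_imp_algebraic[of \<xi>] by auto
  have \<gamma>: "\<gamma> \<ge> 1" unfolding assms(1) using real_le_rsqrt[of 1 5] by simp
  define K where "K = \<bar>\<xi>\<bar> + 2"
  show ?thesis
  proof (rule exI[of _ "280 * K^3"], intro conjI allI)
    show "280 * K^3 > 0" by (simp add: K_def)
    fix B :: real
    obtain p q r s :: int
      where pq: "p * s - q * r = 1" "q > 0" "real_of_int q > B" "0 \<le> s" "s \<le> q"
        "\<bar>q * \<xi> - p\<bar> \<le> 1 / q" "\<bar>s * \<xi> - r\<bar> \<le> 2 / q"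
      by (rule unimodular_approximation[OF irrational])
    interpret unimodular_approx \<xi> K p q r s
      by standard (use pq K_def in auto)
    define Y where "Y = 40 * K^3 * q^2"
    have "real_of_int q * 1 \<le> real_of_int q * real_of_int q" using q_ge_1 by (intro mult_left_mono) auto
    then have YB: "Y \<ge> B" and Y1: "Y \<ge> 1"
      using scale_bounds(1,4) pq(3) unfolding Y_def power2_eq_square of_int_mult of_int_numeral by linarith+
    obtain P where P: "irreducible P" "lead_coeff P = 1" "degree P = 3"
      "real_of_int (poly_height P) \<le> Y" "two_close_real_roots P \<xi> (1 / q^2)"
      using exists_cubic unfolding Y_def by blast
    obtain Q where Q: "irreducible Q" "degree Q = 2"
      "real_of_int (poly_height Q) \<le> Y" "two_close_real_roots Q \<xi> (7 / q^2)"
      using exists_quadratic unfolding Y_def by blast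
    have "7 / q^2 = 280 * K^3 * Y powr (-1)"
      using K_ge_2 q Y1 by (simp add: Y_def powr_minus field_simps)
    also have "\<dots> \<le> 280 * K^3 * Y powr (- (3 - \<gamma>) / 2)"
      using Y1 \<gamma> K_ge_2 by (intro mult_left_mono powr_mono) auto
    finally have le: "7 / q^2 \<le> 280 * K^3 * Y powr (- (3 - \<gamma>) / 2)" .
    have "1 / (real_of_int q)^2 \<le> 7 / q^2" by (simp add: divide_right_mono)
    then have "1 / q^2 \<le> 280 * K^3 * Y powr (- (3 - \<gamma>) / 2)" using le by simp
    then show "\<exists>Y\<ge>B. 1 \<le> Y \<and>
      (\<exists>P Q :: int poly.
         irreducible P \<and> lead_coeff P = 1 \<and> degree P = 3 \<and>
         irreducible Q \<and> degree Q = 2 \<and>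
         real_of_int (poly_height P) \<le> Y \<and> real_of_int (poly_height Q) \<le> Y \<and>
         two_close_real_roots P \<xi> (280 * K^3 * Y powr (- (3 - \<gamma>) / 2)) \<and>
         two_close_real_roots Q \<xi> (280 * K^3 * Y powr (- (3 - \<gamma>) / 2)))"
      using YB Y1 P Q le two_close_real_roots_mono by blast
  qed
qed

end
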